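(* There exists a universal constant $C>0$ such that the following holds. Let $X=\sum_{i=1}^n x_i$, where $x_1,\dots,x_n$ are independent random variables, each symmetric around $0$, with $|x_i|\le a_i$ almost surely for real numbers $a_i\geq 0$, and let $F(t)=\Pr[X>t]$. Set $m=2\max_i a_i$ and let $c\in(0,1)$. If $\epsilon=F(t)$ for some $t\ge0$, and $\delta\ge0$ is minimal such that $F(t+\delta)\le c\cdot F(t)$, then $$\delta\;\le\; C\left(m+\log(2/c)\sqrt{\frac{\sum_i a_i^2}{\log(1/\epsilon)}}\right).$$
   Context: A real random variable $x$ is symmetric around $0$ if $x$ and $-x$ have the same distribution. $\log$ is the natural logarithm. If $\epsilon=0$, then $\log(1/\epsilon)=+\infty$ and the square root is interpreted as $0$. *)

theory Defs
  imports "HOL-Probability.Probability"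
begin

definition symmetric_rv :: "'a measure \<Rightarrow> ('a \<Rightarrow> real) \<Rightarrow> bool" where
  "symmetric_rv M X \<longleftrightarrow> X \<in> borel_measurable M \<and>
     distr M borel X = distr M borel (\<lambda>\<omega>. - X \<omega>)"

definition upper_tail :: "'a measure \<Rightarrow> ('a \<Rightarrow> real) \<Rightarrow> real \<Rightarrow> real" where
  "upper_tail M X t = measure M {\<omega> \<in> space M. X \<omega> > t}"

definition independent_symmetric_bounded ::
  "'a measure \<Rightarrow> nat \<Rightarrow> (nat \<Rightarrow> real) \<Rightarrow> (nat \<Rightarrow> 'a \<Rightarrow> real) \<Rightarrow> bool" where
  "independent_symmetric_bounded M n a x \<longleftrightarrow>
     prob_space M \<and>
     prob_space.indep_vars M (\<lambda>_. borel) x {1..n} \<and>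
     (\<forall>i\<in>{1..n}. symmetric_rv M (x i) \<and> 0 \<le> a i \<and> (AE \<omega> in M. \<bar>x i \<omega>\<bar> \<le> a i))"

definition minimal_decay_step :: "(real \<Rightarrow> real) \<Rightarrow> real \<Rightarrow> real \<Rightarrow> real \<Rightarrow> bool" where
  "minimal_decay_step F c t \<delta> \<longleftrightarrow>
     0 \<le> \<delta> \<and> F (t + \<delta>) \<le> c * F t \<and>
     (\<forall>\<delta>'\<ge>0. F (t + \<delta>') \<le> c * F t \<longrightarrow> \<delta> \<le> \<delta>')"

text \<open>The value \<open>\<epsilon> = 0\<close> stands for \<open>log (1/\<epsilon>) = \<infinity>\<close>, for which the
  square root is \<open>0\<close>.\<close>

definition deviation_scale :: "real \<Rightarrow> real \<Rightarrow> real" where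
  "deviation_scale v \<epsilon> = (if \<epsilon> = 0 then 0 else sqrt (v / ln (1 / \<epsilon>)))"

text \<open>The tail bound with constant \<open>C\<close>, for all families of random variables on the
  given probability space. It is named so that one value of \<open>C\<close> can be used with sample
  spaces of different types, since HOL cannot quantify over types below \<open>\<exists>C\<close>.\<close>

definition tail_decay_bound :: "real \<Rightarrow> 'a measure \<Rightarrow> bool" where
  "tail_decay_bound C M \<longleftrightarrow>
     (\<forall>(n::nat) (a :: nat \<Rightarrow> real) (x :: nat \<Rightarrow> 'a \<Rightarrow> real) (c::real) (t::real) (\<delta>::real).
        let X = (\<lambda>\<omega>. \<Sum>i=1..n. x i \<omega>);
            F = upper_tail M X;
            m = 2 * Max (a ` {1..n});
            \<epsilon> = F t
        in 1 \<le> n \<and> independent_symmetric_bounded M n a x \<and> 0 < c \<and> c < 1 \<and> 0 \<le> t \<and>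
           minimal_decay_step F c t \<delta> \<longrightarrow>
           \<delta> \<le> C * (m + ln (2 / c) * deviation_scale (\<Sum>i=1..n. (a i)\<^sup>2) \<epsilon>))"

end

theory Submission
  imports Defs
begin

text \<open>
  The tail \<open>F\<close> of a sum of independent variables that are bounded by \<open>m/2\<close> is log-concave
  up to a shift by \<open>m\<close>: if \<open>a \<le> c \<le> d\<close>, then \<open>F(a) F(d) \<le> F(a + d - c - m) F(c)\<close>. To see
  this, reveal the summands of two independent copies of the sum one by one, and exchange the
  remaining summands of the copies as soon as the second partial sum leads the first one by
  more than \<open>c - a\<close>. The lead overshoots \<open>c - a\<close> by at most \<open>m\<close>, the largest possible
  difference of two summands, and the exchange preserves the joint law. It sends the event
  that the copies exceed \<open>a\<close> and \<open>d\<close> into the event that they exceed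
  \<open>a + d - c - m\<close> and \<open>c\<close>. Formally this is an induction on the number of summands
  (\<open>log_concave_up_to_shift_upper_tail_sum\<close>), whose step is
  \<open>log_concave_up_to_shift_average\<close>.

  Log-concavity means that the tail decays at least as fast at \<open>t\<close> as it does on average
  before \<open>t\<close>. Splitting \<open>[0, t]\<close> into about \<open>t/\<delta>\<close> steps, over which the tail falls from
  about \<open>1/2\<close> to \<open>\<epsilon> = F(t)\<close>, one finds that \<open>F(t + \<delta> + m) / F(t)\<close> is at most about
  \<open>(2 \<epsilon>) powr (\<delta> / t)\<close>. Hoeffding's inequality gives
  \<open>t \<le> sqrt (2 (\<Sum>i. (a i)\<^sup>2) ln (1/\<epsilon>))\<close>, so a step \<open>\<delta>\<close> of order
  \<open>ln (2/c) sqrt ((\<Sum>i. (a i)\<^sup>2) / ln (1/\<epsilon>))\<close> makes this quotient at most \<open>c\<close>. The shift \<open>m\<close>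
  is paid only once. When \<open>c\<close> is so small that such a step is long compared to \<open>t\<close>, the
  comparison is made instead with a single step across the origin, to which Hoeffding's
  inequality applies directly. Both cases are in \<open>tail_decay_of_log_concave_up_to_shift\<close>.

  Hypotheses and conclusion depend only on the joint law of the summands, a measure on
  real sequences; this carries a constant from that sample space to all others
  (\<open>tail_decay_bound_from_joint_law\<close>).
\<close>

section \<open>Approximate log-concavity of tails\<close>

text \<open>For \<open>m = 0\<close> and \<open>F\<close> positive, this is log-concavity: the values at \<open>a\<close> and \<open>d\<close> are
  compared with those at two points in between that have the same sum.\<close>

definition log_concave_up_to_shift :: "real \<Rightarrow> (real \<Rightarrow> real) \<Rightarrow> bool" where
  "log_concave_up_to_shift m F \<longleftrightarrow>
     (\<forall>a c d. a \<le> c \<longrightarrow> c \<le> d \<longrightarrow> F a * F d \<le> F (a + d - c - m) * F c)"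

lemma borel_measurable_antimono:
  fixes F :: "real \<Rightarrow> real"
  assumes "antimono F"
  shows "F \<in> borel_measurable borel"
proof -
  have "mono (\<lambda>s. - F s)"
    using assms by (auto simp: mono_def antimono_def)
  from borel_measurable_mono[OF this] have "(\<lambda>s. - (- F s)) \<in> borel_measurable borel"
    by (rule borel_measurable_uminus)
  then show ?thesis by simp
qed

text \<open>Convolving with the law of \<open>X\<close> preserves the inequality, because after integration over
  two independent copies \<open>x, y\<close> of \<open>X\<close> it holds pointwise. As long as \<open>y - x\<close> does not exceed
  \<open>c - a\<close>, this is the inequality for \<open>F\<close> itself at the translated points. Otherwise the copies
  are to be exchanged at once: the two factors on the right, taken in the opposite order,
  dominate those on the left by monotonicity alone, and \<open>y - x \<le> 2 r \<le> m\<close> is what makes the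
  shift large enough.\<close>

lemma log_concave_up_to_shift_average:
  fixes F :: "real \<Rightarrow> real"
  assumes "prob_space N" and X: "X \<in> borel_measurable N"
    and bounded: "AE \<omega> in N. \<bar>X \<omega>\<bar> \<le> r"
    and F01: "\<And>s. 0 \<le> F s" "\<And>s. F s \<le> 1" and F: "antimono F"
    and lc: "log_concave_up_to_shift m F" and rm: "2 * r \<le> m"
  shows "log_concave_up_to_shift m (\<lambda>s. \<integral>\<omega>. F (s - X \<omega>) \<partial>N)"
proof -
  interpret N: prob_space N by fact
  note [measurable] = X borel_measurable_antimono[OF F]
  have int: "integrable N (\<lambda>\<omega>. F (s - X \<omega>))" for s
    by (rule N.integrable_const_bound[where B=1]) (use F01 in \<open>auto intro!: AE_I2\<close>)
  have pointwise: "F (a - x) * F (d - y) \<le> F (a + d - c - m - x) * F (c - y)"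
    if "a \<le> c" "c \<le> d" "\<bar>x\<bar> \<le> r" "\<bar>y\<bar> \<le> r" for a c d x y
  proof (cases "y - x \<le> c - a")
    case True
    have "F (a - x) * F (d - y) \<le> F ((a - x) + (d - y) - (c - y) - m) * F (c - y)"
      using True that by (intro lc[unfolded log_concave_up_to_shift_def, rule_format]) auto
    also have "(a - x) + (d - y) - (c - y) - m = a + d - c - m - x" by simp
    finally show ?thesis .
  next
    case False
    have "F (a - x) \<le> F (c - y)" "F (d - y) \<le> F (a + d - c - m - x)"
      using False that rm by (auto intro!: antimonoD[OF F])
    then have "F (a - x) * F (d - y) \<le> F (c - y) * F (a + d - c - m - x)"
      using F01 by (intro mult_mono) auto
    then show ?thesis by (simp add: mult.commute)
  qed
  show ?thesis
    unfolding log_concave_up_to_shift_def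
  proof (intro allI impI)
    fix a c d :: real assume acd: "a \<le> c" "c \<le> d"
    let ?I = "\<lambda>s. \<integral>\<omega>. F (s - X \<omega>) \<partial>N"
    have inner: "?I a * F (d - X \<eta>) \<le> ?I (a + d - c - m) * F (c - X \<eta>)"
      if "\<bar>X \<eta>\<bar> \<le> r" for \<eta>
    proof -
      have "(\<integral>\<omega>. F (a - X \<omega>) * F (d - X \<eta>) \<partial>N) \<le> (\<integral>\<omega>. F (a + d - c - m - X \<omega>) * F (c - X \<eta>) \<partial>N)"
        by (rule integral_mono_AE)
           (use bounded that acd in \<open>auto intro!: int integrable_mult_left pointwise elim!: eventually_mono\<close>)
      then show ?thesis by simp
    qed
    have "(\<integral>\<eta>. ?I a * F (d - X \<eta>) \<partial>N) \<le> (\<integral>\<eta>. ?I (a + d - c - m) * F (c - X \<eta>) \<partial>N)"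
      by (rule integral_mono_AE)
         (use bounded in \<open>auto intro!: int integrable_mult_right inner elim!: eventually_mono\<close>)
    then show "?I a * ?I d \<le> ?I (a + d - c - m) * ?I c" by simp
  qed
qed

lemma antimono_upper_tail:
  assumes "prob_space M" and [measurable]: "X \<in> borel_measurable M"
  shows "antimono (upper_tail M X)"
proof -
  interpret prob_space M by fact
  show ?thesis
    unfolding upper_tail_def by (intro antimonoI finite_measure_mono) auto
qed

lemma upper_tail_bounds:
  assumes "prob_space M"
  shows "0 \<le> upper_tail M X s" "upper_tail M X s \<le> 1"
  using prob_space.prob_le_1[OF assms] by (auto simp: upper_tail_def)

lemma upper_tail_eq_distr:
  assumes [measurable]: "X \<in> borel_measurable M"
  shows "upper_tail M X s = measure (distr M borel X) {s<..}"
  unfolding upper_tail_def by (subst measure_distr) (auto intro!: arg_cong[where f="measure M"])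

lemma upper_tail_add_indep:
  assumes "prob_space M" and ind: "prob_space.indep_var M borel X borel Y"
  shows "upper_tail M (\<lambda>\<omega>. X \<omega> + Y \<omega>) s = (\<integral>\<omega>. upper_tail M Y (s - X \<omega>) \<partial>M)"
proof -
  interpret prob_space M by fact
  have [measurable]: "X \<in> borel_measurable M" "Y \<in> borel_measurable M"
    using ind by (auto dest: indep_var_rv1 indep_var_rv2)
  have anti: "antimono (upper_tail M Y)"
    by (intro antimono_upper_tail prob_space_axioms) simp
  note [measurable] = borel_measurable_antimono[OF anti]
  have nonneg: "0 \<le> upper_tail M Y s" for s
    by (simp add: upper_tail_def)
  interpret DX: prob_space "distr M borel X" by (rule prob_space_distr) simp
  interpret DY: prob_space "distr M borel Y" by (rule prob_space_distr) simp
  have "emeasure (distr M borel (\<lambda>\<omega>. X \<omega> + Y \<omega>)) {s<..}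
      = (\<integral>\<^sup>+x. emeasure (distr M borel Y) {y. y + x \<in> {s<..}} \<partial>distr M borel X)"
    unfolding sum_indep_random_variable[OF ind \<open>X \<in> borel_measurable M\<close> \<open>Y \<in> borel_measurable M\<close>]
    by (rule convolution_emeasure) (simp_all add: DX.finite_measure_axioms DY.finite_measure_axioms)
  also have "\<dots> = (\<integral>\<^sup>+x. ennreal (upper_tail M Y (s - x)) \<partial>distr M borel X)"
  proof (rule nn_integral_cong)
    fix x
    have "{y. y + x \<in> {s<..}} = {s - x<..}" by auto
    then show "emeasure (distr M borel Y) {y. y + x \<in> {s<..}} = ennreal (upper_tail M Y (s - x))"
      by (simp add: upper_tail_eq_distr DY.emeasure_eq_measure)
  qed
  also have "\<dots> = (\<integral>\<^sup>+\<omega>. ennreal (upper_tail M Y (s - X \<omega>)) \<partial>M)"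
    by (subst nn_integral_distr) auto
  also have "\<dots> = ennreal (\<integral>\<omega>. upper_tail M Y (s - X \<omega>) \<partial>M)"
    by (rule nn_integral_eq_integral)
       (auto simp: nonneg upper_tail_def intro!: integrable_const_bound[where B=1])
  finally have "ennreal (measure (distr M borel (\<lambda>\<omega>. X \<omega> + Y \<omega>)) {s<..})
      = ennreal (\<integral>\<omega>. upper_tail M Y (s - X \<omega>) \<partial>M)"
    by (subst (asm) finite_measure.emeasure_eq_measure[OF finite_measure_distr]) simp_all
  then show ?thesis
    by (subst (asm) ennreal_inj) (auto simp: nonneg upper_tail_eq_distr intro!: integral_nonneg_AE)
qed

text \<open>Adding an independent summand averages the tail over its translates by that summand, and
  averaging preserves the inequality.\<close>

theorem log_concave_up_to_shift_upper_tail_sum: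
  assumes "prob_space M" and "finite I"
    and "prob_space.indep_vars M (\<lambda>_. borel) x I"
    and "\<And>i. i \<in> I \<Longrightarrow> AE \<omega> in M. \<bar>x i \<omega>\<bar> \<le> r" and "2 * r \<le> m" and "0 \<le> m"
  shows "log_concave_up_to_shift m (upper_tail M (\<lambda>\<omega>. \<Sum>i\<in>I. x i \<omega>))"
  using assms(2-4)
proof (induction I rule: finite_induct)
  case empty
  interpret prob_space M by fact
  have "upper_tail M (\<lambda>\<omega>. \<Sum>i\<in>{}. x i \<omega>) = (\<lambda>s. if s < 0 then 1 else 0)"
    by (auto simp: upper_tail_def prob_space)
  then show ?case
    using \<open>0 \<le> m\<close> by (auto simp: log_concave_up_to_shift_def)
next
  case (insert i I)
  interpret prob_space M by fact
  let ?Y = "\<lambda>\<omega>. \<Sum>j\<in>I. x j \<omega>"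
  have IH: "log_concave_up_to_shift m (upper_tail M ?Y)"
    using insert.prems by (intro insert.IH indep_vars_subset[OF insert.prems(1)]) auto
  have ind: "indep_var borel (x i) borel ?Y"
    using insert.hyps insert.prems(1) by (rule indep_vars_sum)
  have rv: "x i \<in> borel_measurable M" "?Y \<in> borel_measurable M"
    using ind by (auto dest: indep_var_rv1 indep_var_rv2)
  have "log_concave_up_to_shift m (\<lambda>s. \<integral>\<omega>. upper_tail M ?Y (s - x i \<omega>) \<partial>M)"
    by (rule log_concave_up_to_shift_average[where r=r])
       (use assms rv insert.prems(2) in
         \<open>auto intro: antimono_upper_tail IH simp: upper_tail_bounds\<close>)
  then show ?case
    using insert.hyps by (simp add: upper_tail_add_indep[OF \<open>prob_space M\<close> ind])
qed

section \<open>From approximate log-concavity to decay\<close>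

text \<open>Comparing the step from \<open>t\<close> to \<open>t + \<delta> + m\<close> with each of the \<open>k\<close> steps of length \<open>\<delta>\<close>
  that end at \<open>t\<close>, and multiplying, makes the product on the right telescope.\<close>

lemma log_concave_up_to_shift_iterate:
  assumes lc: "log_concave_up_to_shift m F" and nonneg: "\<And>s. 0 \<le> F s"
    and "0 \<le> m" "0 \<le> \<delta>"
  shows "F (t + \<delta> + m) ^ k * F (t - real k * \<delta>) \<le> F t ^ k * F t"
proof (induction k)
  case 0
  then show ?case by simp
next
  case (Suc k)
  have "0 \<le> real k * \<delta>" using \<open>0 \<le> \<delta>\<close> by simp
  then have "F (t - real (Suc k) * \<delta>) * F (t + \<delta> + m)
      \<le> F ((t - real (Suc k) * \<delta>) + (t + \<delta> + m) - (t - real k * \<delta>) - m) * F (t - real k * \<delta>)"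
    using \<open>0 \<le> m\<close> \<open>0 \<le> \<delta>\<close>
    by (intro lc[unfolded log_concave_up_to_shift_def, rule_format]) (auto simp: algebra_simps)
  also have "(t - real (Suc k) * \<delta>) + (t + \<delta> + m) - (t - real k * \<delta>) - m = t"
    by (simp add: algebra_simps)
  finally have step: "F (t + \<delta> + m) * F (t - real (Suc k) * \<delta>) \<le> F t * F (t - real k * \<delta>)"
    by (simp add: mult.commute)
  have "F (t + \<delta> + m) ^ Suc k * F (t - real (Suc k) * \<delta>)
      = F (t + \<delta> + m) ^ k * (F (t + \<delta> + m) * F (t - real (Suc k) * \<delta>))"
    by simp
  also have "\<dots> \<le> F (t + \<delta> + m) ^ k * (F t * F (t - real k * \<delta>))"
    using step nonneg by (intro mult_left_mono) auto
  also have "\<dots> = F t * (F (t + \<delta> + m) ^ k * F (t - real k * \<delta>))"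
    by simp
  also have "\<dots> \<le> F t * (F t ^ k * F t)"
    using Suc.IH nonneg by (intro mult_left_mono)
  finally show ?case by simp
qed

text \<open>With \<open>L = ln (1 / F t)\<close> and \<open>\<kappa> = ln (2 / c)\<close>, so that \<open>c = 2 exp (- \<kappa>)\<close>, the step is
  \<open>\<delta> = 4 \<kappa> sqrt (v / L)\<close>. If \<open>\<kappa> \<ge> L / 2\<close>, then \<open>\<delta>\<^sup>2 \<ge> 8 v \<kappa>\<close>, so the Gaussian bound at
  \<open>\<delta> / 2\<close> already gives a factor \<open>exp (- \<kappa>)\<close>. If \<open>\<kappa> < L / 2\<close>, then
  \<open>log_concave_up_to_shift_iterate\<close> is used with the least number \<open>k\<close> of steps that reach the
  negative half-line, and \<open>c ^ k \<ge> 2 F t\<close> holds because the Gaussian bound at \<open>t\<close> limits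
  \<open>t / \<delta>\<close>, and hence \<open>k\<close>.\<close>

lemma tail_decay_of_log_concave_up_to_shift:
  fixes F :: "real \<Rightarrow> real"
  assumes lc: "log_concave_up_to_shift m F" and nonneg: "\<And>s. 0 \<le> F s"
    and half: "\<And>s. s < 0 \<Longrightarrow> 1 / 2 \<le> F s" "F t \<le> 1 / 2"
    and gauss: "\<And>s. 0 \<le> s \<Longrightarrow> F s \<le> exp (- s\<^sup>2 / (2 * v))"
    and "0 \<le> m" "0 < v" "0 \<le> t" "0 < F t" "0 < c" "c < 1"
  shows "F (t + 4 * ln (2 / c) * sqrt (v / ln (1 / F t)) + m) \<le> c * F t"
proof -
  define L \<kappa> \<delta> where "L = ln (1 / F t)" and "\<kappa> = ln (2 / c)" and "\<delta> = 4 * \<kappa> * sqrt (v / L)"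
  have "L > 0" "\<kappa> > 0"
    using assms by (auto simp: L_def \<kappa>_def ln_div)
  then have "\<delta> > 0"
    using \<open>0 < v\<close> by (simp add: \<delta>_def)
  have \<delta>_sq: "\<delta>\<^sup>2 = 16 * \<kappa>\<^sup>2 * (v / L)"
    using \<open>L > 0\<close> \<open>0 < v\<close> by (simp add: \<delta>_def power_mult_distrib)
  have Ft: "F t = exp (- L)"
    using \<open>0 < F t\<close> by (simp add: L_def ln_div)
  have c: "c = 2 * exp (- \<kappa>)"
    using \<open>0 < c\<close> by (simp add: \<kappa>_def ln_div exp_diff)
  have "F (t + \<delta> + m) \<le> c * F t"
  proof (cases "L / 2 \<le> \<kappa>")
    case True
    \<comment> \<open>The step to compare with is centred at the origin: \<open>F\<close> is at least \<open>1/2\<close> at its left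
      end and is controlled by the Gaussian bound at its right end.\<close>
    have "F (- \<delta> / 2) * F (t + \<delta> + m) \<le> F ((- \<delta> / 2) + (t + \<delta> + m) - \<delta> / 2 - m) * F (\<delta> / 2)"
      using \<open>\<delta> > 0\<close> \<open>0 \<le> t\<close> \<open>0 \<le> m\<close>
      by (intro lc[unfolded log_concave_up_to_shift_def, rule_format]) auto
    then have "F (- \<delta> / 2) * F (t + \<delta> + m) \<le> F t * F (\<delta> / 2)"
      by simp
    moreover have "1 / 2 * F (t + \<delta> + m) \<le> F (- \<delta> / 2) * F (t + \<delta> + m)"
      using nonneg half(1) \<open>\<delta> > 0\<close> by (intro mult_right_mono) auto
    moreover have "F t * F (\<delta> / 2) \<le> F t * exp (- \<kappa>)"
    proof (rule mult_left_mono)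
      have "F (\<delta> / 2) \<le> exp (- (\<delta> / 2)\<^sup>2 / (2 * v))"
        using gauss \<open>\<delta> > 0\<close> by simp
      also have "- (\<delta> / 2)\<^sup>2 / (2 * v) = - (2 * \<kappa>\<^sup>2 / L)"
        using \<open>0 < v\<close> \<open>L > 0\<close> by (simp add: power_divide \<delta>_sq field_simps)
      also have "\<dots> \<le> - \<kappa>"
        using mult_left_mono[OF True, of \<kappa>] \<open>L > 0\<close> \<open>\<kappa> > 0\<close>
        by (simp add: field_simps power2_eq_square)
      finally show "F (\<delta> / 2) \<le> exp (- \<kappa>)" by simp
    qed (fact nonneg)
    ultimately show ?thesis by (simp add: c mult.commute)
  next
    case False
    \<comment> \<open>The \<open>+ 1\<close> makes \<open>t - k \<delta>\<close> strictly negative: at \<open>0\<close> itself the tail can be far below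
      \<open>1/2\<close>, since the sum may have an atom there.\<close>
    define k where "k = nat \<lfloor>t / \<delta>\<rfloor> + 1"
    have k: "t / \<delta> < real k" "real k \<le> t / \<delta> + 1"
      using \<open>0 \<le> t\<close> \<open>\<delta> > 0\<close> unfolding k_def by (auto simp: nat_add_distrib) linarith+
    have "t - real k * \<delta> < 0"
      using k(1) \<open>\<delta> > 0\<close> by (simp add: field_simps)
    then have "F (t + \<delta> + m) ^ k * (1 / 2) \<le> F (t + \<delta> + m) ^ k * F (t - real k * \<delta>)"
      using nonneg half(1) by (intro mult_left_mono) auto
    also have "\<dots> \<le> F t ^ k * F t"
      using \<open>0 \<le> m\<close> \<open>\<delta> > 0\<close> by (intro log_concave_up_to_shift_iterate lc nonneg) auto
    finally have upper: "F (t + \<delta> + m) ^ k \<le> F t ^ k * (2 * F t)"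
      by simp
    have "t \<le> 2 * sqrt (v * L)"
    proof -
      have "t\<^sup>2 / (2 * v) \<le> L"
        using gauss[OF \<open>0 \<le> t\<close>] by (simp add: Ft)
      then have "t\<^sup>2 \<le> 2 * (v * L)"
        using \<open>0 < v\<close> by (simp add: pos_divide_le_eq mult_ac)
      moreover have "0 < v * L"
        using \<open>0 < v\<close> \<open>L > 0\<close> by (rule mult_pos_pos)
      ultimately have "t\<^sup>2 \<le> 4 * (v * L)" by linarith
      then have "t \<le> sqrt (4 * (v * L))"
        by (rule real_le_rsqrt)
      then show ?thesis by (simp add: real_sqrt_mult)
    qed
    also have "sqrt (v * L) = L * sqrt (v / L)"
    proof -
      have "v * L = L\<^sup>2 * (v / L)" by (simp add: power2_eq_square)
      then have "sqrt (v * L) = sqrt (L\<^sup>2) * sqrt (v / L)"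
        by (simp only: real_sqrt_mult)
      then show ?thesis using \<open>L > 0\<close> by simp
    qed
    finally have "2 * \<kappa> * t \<le> 2 * \<kappa> * (2 * (L * sqrt (v / L)))"
      using \<open>\<kappa> > 0\<close> by (intro mult_left_mono) auto
    then have "t / \<delta> \<le> L / (2 * \<kappa>)"
      using \<open>\<delta> > 0\<close> \<open>\<kappa> > 0\<close> by (simp add: field_simps) (simp add: \<delta>_def algebra_simps)
    then have "real k \<le> L / (2 * \<kappa>) + 1" using k(2) by simp
    moreover have "0 \<le> \<kappa> - ln 2"
      using \<open>0 < c\<close> \<open>c < 1\<close> by (simp add: \<kappa>_def ln_div)
    \<comment> \<open>Since \<open>\<kappa> - ln 2 = ln (1 / c)\<close>, this chain says that \<open>c ^ k \<ge> 2 F t\<close>.\<close>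
    ultimately have "real k * (\<kappa> - ln 2) \<le> (L / (2 * \<kappa>) + 1) * (\<kappa> - ln 2)"
      by (intro mult_right_mono) auto
    also have "\<dots> \<le> L / (2 * \<kappa>) * \<kappa> + (\<kappa> - ln 2)"
    proof -
      have "L / (2 * \<kappa>) * (\<kappa> - ln 2) \<le> L / (2 * \<kappa>) * \<kappa>"
        using \<open>L > 0\<close> \<open>\<kappa> > 0\<close> by (intro mult_left_mono) auto
      then show ?thesis by (simp only: distrib_right mult_1_left add_right_mono)
    qed
    also have "\<dots> \<le> L - ln 2"
      using False \<open>\<kappa> > 0\<close> by simp
    finally have "exp (ln 2 - L) \<le> exp (real k * (ln 2 - \<kappa>))"
      by (simp add: algebra_simps)
    moreover have "exp (ln 2 - \<kappa>) = c"
      by (simp add: c exp_diff exp_minus divide_inverse)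
    then have "exp (real k * (ln 2 - \<kappa>)) = c ^ k"
      by (simp only: exp_of_nat_mult)
    moreover have "exp (ln 2 - L) = 2 * F t"
      by (simp add: Ft exp_diff exp_minus divide_inverse)
    ultimately have "2 * F t \<le> c ^ k" by simp
    then have "F t ^ k * (2 * F t) \<le> F t ^ k * c ^ k"
      using nonneg by (intro mult_left_mono) auto
    with upper have "F (t + \<delta> + m) ^ k \<le> (c * F t) ^ k"
      by (simp add: power_mult_distrib mult.commute)
    then show ?thesis
      using nonneg \<open>0 < c\<close> power_mono_iff[of "F (t + \<delta> + m)" "c * F t" k] by (simp add: k_def)
  qed
  then show ?thesis by (simp add: \<delta>_def \<kappa>_def L_def)
qed

section \<open>Sums of symmetric variables\<close>

lemma symmetric_rv_sum:
  assumes "prob_space M" and "finite I"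
    and "prob_space.indep_vars M (\<lambda>_. borel) x I"
    and "\<And>i. i \<in> I \<Longrightarrow> symmetric_rv M (x i)"
  shows "symmetric_rv M (\<lambda>\<omega>. \<Sum>i\<in>I. x i \<omega>)"
  using assms(2-4)
proof (induction I rule: finite_induct)
  case empty
  then show ?case by (simp add: symmetric_rv_def)
next
  case (insert i I)
  interpret prob_space M by fact
  let ?Y = "\<lambda>\<omega>. \<Sum>j\<in>I. x j \<omega>"
  have IH: "symmetric_rv M ?Y"
    using insert.prems by (intro insert.IH indep_vars_subset[OF insert.prems(1)]) auto
  have ind: "indep_var borel (x i) borel ?Y"
    using insert.hyps insert.prems(1) by (rule indep_vars_sum)
  have rv [measurable]: "x i \<in> borel_measurable M" "?Y \<in> borel_measurable M"
    using ind by (auto dest: indep_var_rv1 indep_var_rv2)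
  have "indep_var borel (uminus \<circ> x i) borel (uminus \<circ> ?Y)"
    by (rule indep_var_compose[OF ind]) auto
  then have ind': "indep_var borel (\<lambda>\<omega>. - x i \<omega>) borel (\<lambda>\<omega>. - ?Y \<omega>)"
    by (simp add: o_def)
  have "distr M borel (\<lambda>\<omega>. x i \<omega> + ?Y \<omega>)
      = convolution (distr M borel (\<lambda>\<omega>. - x i \<omega>)) (distr M borel (\<lambda>\<omega>. - ?Y \<omega>))"
    using IH insert.prems(2)[of i]
    by (simp add: sum_indep_random_variable[OF ind] symmetric_rv_def)
  also have "\<dots> = distr M borel (\<lambda>\<omega>. - x i \<omega> + - ?Y \<omega>)"
    by (rule sum_indep_random_variable[OF ind', symmetric]) measurable
  also have "(\<lambda>\<omega>. - x i \<omega> + - ?Y \<omega>) = (\<lambda>\<omega>. - (x i \<omega> + ?Y \<omega>))"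
    by (simp add: fun_eq_iff)
  finally show ?case
    using insert.hyps rv by (simp add: symmetric_rv_def)
qed

lemma symmetric_rv_upper_tail:
  assumes "prob_space M" and sym: "symmetric_rv M X"
  shows "0 \<le> s \<Longrightarrow> upper_tail M X s \<le> 1 / 2" and "s < 0 \<Longrightarrow> 1 / 2 \<le> upper_tail M X s"
proof -
  interpret prob_space M by fact
  have [measurable]: "X \<in> borel_measurable M"
    using sym by (simp add: symmetric_rv_def)
  have "prob {\<omega> \<in> space M. X \<omega> > 0} = measure (distr M borel X) {0<..}"
    by (subst measure_distr) (auto intro!: arg_cong[where f=prob])
  also have "distr M borel X = distr M borel (\<lambda>\<omega>. - X \<omega>)"
    using sym by (simp add: symmetric_rv_def)
  also have "measure \<dots> {0<..} = prob {\<omega> \<in> space M. X \<omega> < 0}"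
    by (subst measure_distr) (auto intro!: arg_cong[where f=prob])
  finally have eq: "prob {\<omega> \<in> space M. X \<omega> > 0} = prob {\<omega> \<in> space M. X \<omega> < 0}" .
  have "prob {\<omega> \<in> space M. \<not> X \<omega> < 0} = 1 - prob {\<omega> \<in> space M. X \<omega> < 0}"
    by (rule prob_neg) simp
  moreover have "prob {\<omega> \<in> space M. X \<omega> > 0} \<le> prob {\<omega> \<in> space M. \<not> X \<omega> < 0}"
    by (rule finite_measure_mono) auto
  moreover have "upper_tail M X s \<le> prob {\<omega> \<in> space M. X \<omega> > 0}" if "0 \<le> s"
    unfolding upper_tail_def using that by (intro finite_measure_mono) auto
  moreover have "prob {\<omega> \<in> space M. \<not> X \<omega> < 0} \<le> upper_tail M X s" if "s < 0"
    unfolding upper_tail_def using that by (intro finite_measure_mono) auto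
  ultimately show "0 \<le> s \<Longrightarrow> upper_tail M X s \<le> 1 / 2" "s < 0 \<Longrightarrow> 1 / 2 \<le> upper_tail M X s"
    using eq by auto
qed

lemma symmetric_rv_expectation:
  assumes "symmetric_rv M X"
  shows "(\<integral>\<omega>. X \<omega> \<partial>M) = 0"
proof -
  have [measurable]: "X \<in> borel_measurable M"
    using assms by (simp add: symmetric_rv_def)
  have "(\<integral>\<omega>. X \<omega> \<partial>M) = (\<integral>y. y \<partial>distr M borel X)"
    by (subst integral_distr) auto
  also have "\<dots> = (\<integral>y. y \<partial>distr M borel (\<lambda>\<omega>. - X \<omega>))"
    using assms by (simp add: symmetric_rv_def)
  also have "\<dots> = - (\<integral>\<omega>. X \<omega> \<partial>M)"
    by (subst integral_distr) auto
  finally show ?thesis by simp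
qed

text \<open>Hoeffding's inequality for the intervals \<open>[- a i, a i]\<close>, whose lengths have squares
  \<open>4 (a i)\<^sup>2\<close>; the means vanish by symmetry.\<close>

lemma upper_tail_sum_le_gaussian:
  assumes "independent_symmetric_bounded M n a x"
    and "0 < (\<Sum>i=1..n. (a i)\<^sup>2)" and "0 \<le> s"
  shows "upper_tail M (\<lambda>\<omega>. \<Sum>i=1..n. x i \<omega>) s \<le> exp (- s\<^sup>2 / (2 * (\<Sum>i=1..n. (a i)\<^sup>2)))"
proof -
  interpret prob_space M
    using assms by (simp add: independent_symmetric_bounded_def)
  interpret H: Hoeffding_ineq M "{1..n}" x "\<lambda>i. - a i" a 0
  proof unfold_locales
    fix i assume "i \<in> {1..n}"
    then have "AE \<omega> in M. \<bar>x i \<omega>\<bar> \<le> a i"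
      using assms(1) by (simp add: independent_symmetric_bounded_def)
    then show "AE \<omega> in M. x i \<omega> \<in> {- a i..a i}"
      by eventually_elim auto
  next
    show "0 \<equiv> \<Sum>i = 1..n. expectation (x i)"
      using assms(1) by (intro eq_reflection)
        (simp add: independent_symmetric_bounded_def symmetric_rv_expectation)
  qed (use assms(1) in \<open>auto simp: independent_symmetric_bounded_def\<close>)
  have four: "(\<Sum>i=1..n. (a i - - a i)\<^sup>2) = 4 * (\<Sum>i=1..n. (a i)\<^sup>2)"
    by (simp add: power2_eq_square algebra_simps sum_distrib_left)
  have "upper_tail M (\<lambda>\<omega>. \<Sum>i=1..n. x i \<omega>) s \<le> prob {\<omega> \<in> space M. (\<Sum>i=1..n. x i \<omega>) \<ge> 0 + s}"
    unfolding upper_tail_def by (intro finite_measure_mono) auto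
  also have "\<dots> \<le> exp (- 2 * s\<^sup>2 / (\<Sum>i=1..n. (a i - - a i)\<^sup>2))"
    by (rule H.Hoeffding_ineq_ge) (use assms four in auto)
  finally show ?thesis
    unfolding four by simp
qed

lemma tail_decay_bound_4:
  assumes "prob_space M"
  shows "tail_decay_bound 4 M"
  unfolding tail_decay_bound_def Let_def
proof (intro allI impI, elim conjE)
  fix n a x and c t \<delta> :: real
  assume "1 \<le> n" and isb: "independent_symmetric_bounded M n a x" and c: "0 < c" "c < 1"
    and "0 \<le> t" and step: "minimal_decay_step (upper_tail M (\<lambda>\<omega>. \<Sum>i=1..n. x i \<omega>)) c t \<delta>"
  interpret prob_space M by fact
  define F where "F = upper_tail M (\<lambda>\<omega>. \<Sum>i=1..n. x i \<omega>)"
  define m where "m = 2 * Max (a ` {1..n})"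
  define v where "v = (\<Sum>i=1..n. (a i)\<^sup>2)"
  have ind: "indep_vars (\<lambda>_. borel) x {1..n}"
    and sym: "\<And>i. i \<in> {1..n} \<Longrightarrow> symmetric_rv M (x i)"
    and a: "\<And>i. i \<in> {1..n} \<Longrightarrow> 0 \<le> a i"
    and bd: "\<And>i. i \<in> {1..n} \<Longrightarrow> AE \<omega> in M. \<bar>x i \<omega>\<bar> \<le> a i"
    using isb by (auto simp: independent_symmetric_bounded_def)
  have sym_sum: "symmetric_rv M (\<lambda>\<omega>. \<Sum>i=1..n. x i \<omega>)"
    by (intro symmetric_rv_sum ind sym prob_space_axioms) auto
  have a_le: "a i \<le> Max (a ` {1..n})" if "i \<in> {1..n}" for i
    using that by (intro Max_ge) auto
  have "0 \<le> m"
    using order_trans[OF a a_le, of 1] \<open>1 \<le> n\<close> unfolding m_def by auto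
  have nonneg: "0 \<le> F s" for s
    by (simp add: F_def upper_tail_def)
  have minimal: "\<delta> \<le> \<delta>'" if "0 \<le> \<delta>'" "F (t + \<delta>') \<le> c * F t" for \<delta>'
    using step that by (simp add: minimal_decay_step_def F_def)
  have "\<delta> \<le> 4 * (m + ln (2 / c) * deviation_scale v (F t))"
  proof (cases "F t = 0")
    case True
    then have "\<delta> \<le> 0" by (intro minimal) auto
    then show ?thesis using True \<open>0 \<le> m\<close> by (simp add: deviation_scale_def)
  next
    case False
    then have "0 < F t" using nonneg[of t] by simp
    have "F t \<le> 1 / 2"
      unfolding F_def by (rule symmetric_rv_upper_tail[OF prob_space_axioms sym_sum]) fact
    \<comment> \<open>If all \<open>a i\<close> vanish, then so does the sum, and \<open>F t = 0\<close>.\<close>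
    have "v \<noteq> 0"
    proof
      assume "v = 0"
      then have "a i = 0" if "i \<in> {1..n}" for i
        using that by (simp add: v_def sum_nonneg_eq_0_iff)
      then have "AE \<omega> in M. \<forall>i\<in>{1..n}. x i \<omega> = 0"
        using bd by (intro AE_finite_allI) auto
      then have "AE \<omega> in M. \<not> (\<Sum>i=1..n. x i \<omega>) > t"
        by eventually_elim (use \<open>0 \<le> t\<close> in simp)
      then have "F t = 0"
        unfolding F_def upper_tail_def by (intro measure_eq_0_null_sets AE_iff_null_sets[THEN iffD2])
           (use sym_sum in \<open>auto simp: symmetric_rv_def\<close>)
      with False show False ..
    qed
    moreover have "0 \<le> v" unfolding v_def by (intro sum_nonneg) auto
    ultimately have "0 < v" by simp
    have scale: "0 \<le> ln (2 / c) * sqrt (v / ln (1 / F t))"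
      using c \<open>0 < v\<close> \<open>0 < F t\<close> \<open>F t \<le> 1 / 2\<close> by (intro mult_nonneg_nonneg) auto
    have "F (t + 4 * ln (2 / c) * sqrt (v / ln (1 / F t)) + m) \<le> c * F t"
    proof (rule tail_decay_of_log_concave_up_to_shift)
      show "log_concave_up_to_shift m F"
        unfolding F_def
      proof (rule log_concave_up_to_shift_upper_tail_sum[where r = "Max (a ` {1..n})"])
        fix i assume i: "i \<in> {1..n}"
        show "AE \<omega> in M. \<bar>x i \<omega>\<bar> \<le> Max (a ` {1..n})"
          using bd[OF i] by eventually_elim (use a_le[OF i] in simp)
      qed (use ind \<open>0 \<le> m\<close> prob_space_axioms in \<open>auto simp: m_def\<close>)
      show "1 / 2 \<le> F s" if "s < 0" for s
        unfolding F_def by (rule symmetric_rv_upper_tail[OF prob_space_axioms sym_sum]) fact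
      show "F s \<le> exp (- s\<^sup>2 / (2 * v))" if "0 \<le> s" for s
        using isb \<open>0 < v\<close> that unfolding F_def v_def by (rule upper_tail_sum_le_gaussian)
    qed fact+
    then have "\<delta> \<le> 4 * ln (2 / c) * sqrt (v / ln (1 / F t)) + m"
      using scale \<open>0 \<le> m\<close> by (intro minimal) (auto simp: add.assoc)
    then show ?thesis
      using \<open>0 \<le> m\<close> False by (simp add: deviation_scale_def)
  qed
  then show "\<delta> \<le> 4 * (2 * Max (a ` {1..n}) + ln (2 / c) *
      deviation_scale (\<Sum>i=1..n. (a i)\<^sup>2) (upper_tail M (\<lambda>\<omega>. \<Sum>i=1..n. x i \<omega>) t))"
    by (simp add: F_def m_def v_def)
qed

section \<open>Passing to the joint law\<close>

text \<open>Under the joint law of \<open>x 1, \<dots>, x n\<close> the coordinate functions have the same joint law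
  as the \<open>x i\<close>, so they satisfy the same hypotheses and their sum has the same tail.\<close>

lemma tail_decay_bound_from_joint_law:
  fixes M :: "'a measure"
  assumes "prob_space M"
    and laws: "\<And>N :: (nat \<Rightarrow> real) measure. prob_space N \<Longrightarrow> tail_decay_bound C N"
  shows "tail_decay_bound C M"
  unfolding tail_decay_bound_def Let_def
proof (intro allI impI, elim conjE)
  fix n :: nat and a :: "nat \<Rightarrow> real" and x :: "nat \<Rightarrow> 'a \<Rightarrow> real" and c t \<delta> :: real
  let ?F = "upper_tail M (\<lambda>\<omega>. \<Sum>i=1..n. x i \<omega>)"
  assume n: "1 \<le> n" and isb: "independent_symmetric_bounded M n a x" and c: "0 < c" "c < 1"
    and t: "0 \<le> t" and step: "minimal_decay_step ?F c t \<delta>"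
  interpret prob_space M by fact
  define T where "T = (\<lambda>\<omega>. \<lambda>i\<in>{1..n}. x i \<omega>)"
  define P where "P = Pi\<^sub>M {1..n} (\<lambda>_. borel :: real measure)"
  define N where "N = distr M P T"
  define y where "y = (\<lambda>i (f :: nat \<Rightarrow> real). f i)"
  have ind: "indep_vars (\<lambda>_. borel) x {1..n}"
    using isb by (simp add: independent_symmetric_bounded_def)
  have x [measurable]: "x i \<in> borel_measurable M" if "i \<in> {1..n}" for i
    using ind that by (auto simp: indep_vars_def)
  have T [measurable]: "T \<in> measurable M P"
    unfolding T_def P_def by (intro measurable_restrict x)
  have y [measurable]: "y i \<in> borel_measurable P" if "i \<in> {1..n}" for i
    unfolding y_def P_def using that by (rule measurable_component_singleton)
  have yN [measurable]: "y i \<in> borel_measurable N" if "i \<in> {1..n}" for i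
    using y[OF that] by (simp add: N_def)
  have yT: "y i (T \<omega>) = x i \<omega>" if "i \<in> {1..n}" for i \<omega>
    using that by (simp add: y_def T_def)
  interpret N: prob_space N
    unfolding N_def by (rule prob_space_distr) (fact T)
  have distr_y: "distr N borel (y i) = distr M borel (x i)"
    "distr N borel (\<lambda>f. - y i f) = distr M borel (\<lambda>\<omega>. - x i \<omega>)" if "i \<in> {1..n}" for i
    using that unfolding N_def by (subst distr_distr; (simp add: o_def yT; measurable)?)+
  have joint: "distr M P T = Pi\<^sub>M {1..n} (\<lambda>i. distr M borel (x i))"
    unfolding P_def T_def using n ind x by (subst (asm) indep_vars_iff_distr_eq_PiM') auto
  have "N.indep_vars (\<lambda>_. borel) y {1..n}"
  proof (subst N.indep_vars_iff_distr_eq_PiM')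
    have "distr N P (\<lambda>f. \<lambda>i\<in>{1..n}. y i f) = distr N P (\<lambda>f. f)"
    proof (rule distr_cong)
      fix f assume "f \<in> space N"
      then show "(\<lambda>i\<in>{1..n}. y i f) = f"
        by (auto simp: N_def P_def y_def space_PiM)
    qed simp_all
    also have "\<dots> = N"
      by (simp add: N_def distr_id2)
    also have "\<dots> = Pi\<^sub>M {1..n} (\<lambda>i. distr N borel (y i))"
    proof -
      have "N = Pi\<^sub>M {1..n} (\<lambda>i. distr M borel (x i))"
        using joint by (simp add: N_def)
      also have "\<dots> = Pi\<^sub>M {1..n} (\<lambda>i. distr N borel (y i))"
        by (rule PiM_cong) (simp_all only: distr_y(1))
      finally show ?thesis .
    qed
    finally show "distr N (Pi\<^sub>M {1..n} (\<lambda>_. borel)) (\<lambda>f. \<lambda>i\<in>{1..n}. y i f)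
        = Pi\<^sub>M {1..n} (\<lambda>i. distr N borel (y i))"
      by (simp add: P_def)
  qed (use n yN in auto)
  moreover have "symmetric_rv N (y i)" if "i \<in> {1..n}" for i
    using isb that distr_y[OF that] yN[OF that]
    by (simp add: symmetric_rv_def independent_symmetric_bounded_def)
  moreover have "AE f in N. \<bar>y i f\<bar> \<le> a i" if "i \<in> {1..n}" for i
    using isb that unfolding N_def
    by (subst AE_distr_iff) (auto simp: yT independent_symmetric_bounded_def)
  ultimately have isb_N: "independent_symmetric_bounded N n a y"
    using isb N.prob_space_axioms by (simp add: independent_symmetric_bounded_def)
  have tail: "upper_tail N (\<lambda>f. \<Sum>i=1..n. y i f) = ?F"
  proof
    fix s
    have "(\<lambda>f. \<Sum>i=1..n. y i f) \<in> borel_measurable P"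
      by (intro borel_measurable_sum y)
    then show "upper_tail N (\<lambda>f. \<Sum>i=1..n. y i f) s = ?F s"
      unfolding upper_tail_def N_def using T measurable_space[OF T]
      by (subst measure_distr) (auto simp: yT intro!: arg_cong[where f=prob] sum.cong)
  qed
  show "\<delta> \<le> C * (2 * Max (a ` {1..n}) + ln (2 / c) * deviation_scale (\<Sum>i=1..n. (a i)\<^sup>2) (?F t))"
    using laws[OF N.prob_space_axioms] n isb_N c t step
    unfolding tail_decay_bound_def Let_def by (metis (no_types, lifting) tail)
qed

theorem theorem1p12:
  shows "(\<exists>C>0. \<forall>M :: (nat \<Rightarrow> real) measure. prob_space M \<longrightarrow> tail_decay_bound C M) \<and>
         (\<forall>C>0. (\<forall>M :: (nat \<Rightarrow> real) measure. prob_space M \<longrightarrow> tail_decay_bound C M) \<longrightarrow>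
                (\<forall>M :: 'a measure. prob_space M \<longrightarrow> tail_decay_bound C M))"
proof (intro conjI)
  show "\<exists>C>0. \<forall>M :: (nat \<Rightarrow> real) measure. prob_space M \<longrightarrow> tail_decay_bound C M"
    by (intro exI[of _ 4]) (simp add: tail_decay_bound_4)
  show "\<forall>C>0. (\<forall>M :: (nat \<Rightarrow> real) measure. prob_space M \<longrightarrow> tail_decay_bound C M) \<longrightarrow>
                (\<forall>M :: 'a measure. prob_space M \<longrightarrow> tail_decay_bound C M)"
    by (blast intro: tail_decay_bound_from_joint_law)
qed

end
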